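(* Let $\mathcal{C}$ be a half-line CMV matrix with spectral measure $\mu$ on $\partial\mathbb{D}$ and orthonormal polynomials $\varphi_n$, and let $d\mu_n(\theta)=|\varphi_n(e^{i\theta})|^2d\mu(\theta)$. If the sequence $\mu_n$ has a weak limit as $n\to\infty$, then all right limits of $\mathcal{C}$ belong to Khrushchev Class.
   Context: Let $\mathbb{D}$ be the open unit disc. A probability measure $\mu$ on $\partial\mathbb{D}$ with infinite support has monic orthogonal polynomials $\Phi_n$ (with orthonormal versions $\varphi_n=\Phi_n/\|\Phi_n\|_{L^2(\mu)}$) satisfying $\Phi_{n+1}(z)=z\Phi_n(z)-\overline{\alpha_n}\,\Phi_n^*(z)$, $\Phi_n^*(z)=z^n\overline{\Phi_n(1/\bar z)}$; the numbers $\alpha_n\in\mathbb{D}$ are the Verblunsky coefficients of $\mu$, and $\mu\leftrightarrow\{\alpha_n\}_{n\ge0}\in\mathbb{D}^{\mathbb{Z}_+}$ is a bijection. The half-line CMV matrix of $\{\alpha_n\}_{n\ge 0}$ is the unitary operator on $\ell^2(\mathbb{Z}_+)$ given by $\mathcal{C}=\mathcal{L}\mathcal{M}$, $\mathcal{L}=\Theta_0\oplus\Theta_2\oplus\cdots$, $\mathcal{M}=(1)\oplus\Theta_1\oplus\Theta_3\oplus\cdots$, $\Theta_k=\begin{pmatrix}\bar\alpha_k&\rho_k\\ \rho_k&-\alpha_k\end{pmatrix}$, $\rho_k=(1-|\alpha_k|^2)^{1/2}$; $\mu$ is its spectral measure, and $\mu_n$ is the spectral measure of $\mathcal{C}$ and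 $\delta_n$. For $\{\widetilde\alpha_n\}_{n\in\mathbb{Z}}$ with $|\widetilde\alpha_n|\le1$, the whole-line CMV matrix is the unitary operator $\mathcal{E}=\mathcal{L}\mathcal{M}$ on $\ell^2(\mathbb{Z})$, with $\mathcal{L}$ the direct sum over $k\in\mathbb{Z}$ of blocks $\Theta_{2k}$ acting on coordinates $2k,2k+1$ and $\mathcal{M}$ the direct sum of blocks $\Theta_{2k-1}$ acting on coordinates $2k-1,2k$ (with $\Theta_k$ formed from $\widetilde\alpha_k$). $\mathcal{E}$ is a right limit of $\mathcal{C}$ if there are integers $n_j\to\infty$ with $\widetilde\alpha_n=\lim_{j\to\infty}\alpha_{n+n_j}$ for every $n\in\mathbb{Z}$. A whole-line CMV matrix $\mathcal{E}$ belongs to Khrushchev Class if $\nu_n=\nu_m$ for all $n,m\in\mathbb{Z}$, where $\nu_j$ is the spectral measure of $\mathcal{E}$ and the standard basis vector $\delta_j$, i.e. $\int e^{i\ell\theta}d\nu_j(\theta)=\langle\delta_j,\mathcal{E}^\ell\delta_j\rangle$ for all $\ell\in\mathbb{Z}$. *)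

theory Defs
  imports "HOL-Probability.Probability" "HOL-Computational_Algebra.Polynomial"
begin

section \<open>Measures on the unit circle\<close>

text \<open>The variable is \<open>z = exp (i \<theta>)\<close>, so measures live on the unit circle
  itself, with its Borel \<open>\<sigma>\<close>-algebra.\<close>

definition circle_algebra :: "complex measure" where
  "circle_algebra = restrict_space borel (sphere 0 1)"

definition circle_prob :: "complex measure \<Rightarrow> bool" where
  "circle_prob \<mu> \<longleftrightarrow> sets \<mu> = sets circle_algebra \<and> prob_space \<mu>"

definition circle_support :: "complex measure \<Rightarrow> complex set" where
  "circle_support \<mu> =
     {z \<in> sphere 0 1. \<forall>U. open U \<longrightarrow> z \<in> U \<longrightarrow> emeasure \<mu> (U \<inter> sphere 0 1) > 0}"

definition weak_limit :: "(nat \<Rightarrow> complex measure) \<Rightarrow> complex measure \<Rightarrow> bool" where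
  "weak_limit \<mu>s \<nu> \<longleftrightarrow> circle_prob \<nu> \<and>
     (\<forall>f :: complex \<Rightarrow> complex. continuous_on (sphere 0 1) f \<longrightarrow>
        (\<lambda>n. \<integral>z. f z \<partial>\<mu>s n) \<longlonglongrightarrow> (\<integral>z. f z \<partial>\<nu>))"


section \<open>Orthogonal polynomials on the unit circle\<close>

definition monic_orthogonal_polys :: "complex measure \<Rightarrow> (nat \<Rightarrow> complex poly) \<Rightarrow> bool" where
  "monic_orthogonal_polys \<mu> \<Phi> \<longleftrightarrow>
     (\<forall>n. degree (\<Phi> n) = n \<and> lead_coeff (\<Phi> n) = 1) \<and>
     (\<forall>m n. m \<noteq> n \<longrightarrow> (\<integral>z. cnj (poly (\<Phi> m) z) * poly (\<Phi> n) z \<partial>\<mu>) = 0)"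

definition L2_norm_poly :: "complex measure \<Rightarrow> complex poly \<Rightarrow> real" where
  "L2_norm_poly \<mu> P = sqrt (\<integral>z. (cmod (poly P z))\<^sup>2 \<partial>\<mu>)"

definition orthonormal_polys :: "complex measure \<Rightarrow> (nat \<Rightarrow> complex poly) \<Rightarrow> bool" where
  "orthonormal_polys \<mu> \<phi> \<longleftrightarrow>
     (\<exists>\<Phi>. monic_orthogonal_polys \<mu> \<Phi> \<and>
        (\<forall>n. \<phi> n = smult (complex_of_real (1 / L2_norm_poly \<mu> (\<Phi> n))) (\<Phi> n)))"


section \<open>Operators on square-summable sequences and their spectral measures\<close>

text \<open>An operator is a map on all sequences; only its restriction to \<open>ell2\<close> matters.\<close>

definition ell2 :: "('i \<Rightarrow> complex) set" where
  "ell2 = {f. (\<lambda>n. (cmod (f n))\<^sup>2) summable_on UNIV}"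

definition ell2_inner :: "('i \<Rightarrow> complex) \<Rightarrow> ('i \<Rightarrow> complex) \<Rightarrow> complex" where
  "ell2_inner f g = (\<Sum>\<^sub>\<infinity>n. cnj (f n) * g n)"

definition delta :: "'i \<Rightarrow> 'i \<Rightarrow> complex" where
  "delta j = (\<lambda>n. if n = j then 1 else 0)"

text \<open>Integer powers of a bijection of \<open>ell2\<close>, in particular of a unitary operator.\<close>

definition op_powi :: "(('i \<Rightarrow> complex) \<Rightarrow> ('i \<Rightarrow> complex)) \<Rightarrow> int \<Rightarrow> ('i \<Rightarrow> complex) \<Rightarrow> ('i \<Rightarrow> complex)"
  where "op_powi T l = (if l \<ge> 0 then T ^^ nat l else inv_into ell2 T ^^ nat (- l))"

definition is_spectral_measure ::
  "(('i \<Rightarrow> complex) \<Rightarrow> ('i \<Rightarrow> complex)) \<Rightarrow> ('i \<Rightarrow> complex) \<Rightarrow> complex measure \<Rightarrow> bool" where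
  "is_spectral_measure T \<psi> \<nu> \<longleftrightarrow>
     sets \<nu> = sets circle_algebra \<and> finite_measure \<nu> \<and>
     (\<forall>l::int. (\<integral>z. z powi l \<partial>\<nu>) = ell2_inner \<psi> (op_powi T l \<psi>))"


section \<open>CMV matrices\<close>

definition rho :: "complex \<Rightarrow> real" where
  "rho a = sqrt (1 - (cmod a)\<^sup>2)"

text \<open>The two coordinates of \<open>\<Theta> (x, y)\<close>, where \<open>\<Theta>\<close> is the matrix with rows
  \<open>(cnj a, rho a)\<close> and \<open>(rho a, - a)\<close>.\<close>

definition theta_fst :: "complex \<Rightarrow> complex \<Rightarrow> complex \<Rightarrow> complex" where
  "theta_fst a x y = cnj a * x + of_real (rho a) * y"

definition theta_snd :: "complex \<Rightarrow> complex \<Rightarrow> complex \<Rightarrow> complex" where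
  "theta_snd a x y = of_real (rho a) * x - a * y"

definition half_L :: "(nat \<Rightarrow> complex) \<Rightarrow> (nat \<Rightarrow> complex) \<Rightarrow> (nat \<Rightarrow> complex)" where
  "half_L \<alpha> f = (\<lambda>n. if even n then theta_fst (\<alpha> n) (f n) (f (n + 1))
                      else theta_snd (\<alpha> (n - 1)) (f (n - 1)) (f n))"

definition half_M :: "(nat \<Rightarrow> complex) \<Rightarrow> (nat \<Rightarrow> complex) \<Rightarrow> (nat \<Rightarrow> complex)" where
  "half_M \<alpha> f = (\<lambda>n. if n = 0 then f 0
                      else if odd n then theta_fst (\<alpha> n) (f n) (f (n + 1))
                      else theta_snd (\<alpha> (n - 1)) (f (n - 1)) (f n))"

definition half_line_cmv :: "(nat \<Rightarrow> complex) \<Rightarrow> (nat \<Rightarrow> complex) \<Rightarrow> (nat \<Rightarrow> complex)" where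
  "half_line_cmv \<alpha> = half_L \<alpha> \<circ> half_M \<alpha>"

definition whole_L :: "(int \<Rightarrow> complex) \<Rightarrow> (int \<Rightarrow> complex) \<Rightarrow> (int \<Rightarrow> complex)" where
  "whole_L \<beta> f = (\<lambda>n. if even n then theta_fst (\<beta> n) (f n) (f (n + 1))
                       else theta_snd (\<beta> (n - 1)) (f (n - 1)) (f n))"

definition whole_M :: "(int \<Rightarrow> complex) \<Rightarrow> (int \<Rightarrow> complex) \<Rightarrow> (int \<Rightarrow> complex)" where
  "whole_M \<beta> f = (\<lambda>n. if odd n then theta_fst (\<beta> n) (f n) (f (n + 1))
                       else theta_snd (\<beta> (n - 1)) (f (n - 1)) (f n))"

definition whole_line_cmv :: "(int \<Rightarrow> complex) \<Rightarrow> (int \<Rightarrow> complex) \<Rightarrow> (int \<Rightarrow> complex)" where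
  "whole_line_cmv \<beta> = whole_L \<beta> \<circ> whole_M \<beta>"

text \<open>\<open>E\<close> is a right limit of the half-line CMV matrix of \<open>\<alpha>\<close>.  Since \<open>N j\<close> tends to
  infinity, \<open>k + N j\<close> is negative for only finitely many \<open>j\<close>, so the truncation by
  \<open>nat\<close> does not affect the limit.\<close>

definition is_right_limit ::
  "(nat \<Rightarrow> complex) \<Rightarrow> ((int \<Rightarrow> complex) \<Rightarrow> (int \<Rightarrow> complex)) \<Rightarrow> bool" where
  "is_right_limit \<alpha> E \<longleftrightarrow>
     (\<exists>(N :: nat \<Rightarrow> int) \<beta>. filterlim N at_top sequentially \<and>
        (\<forall>k. (\<lambda>j. \<alpha> (nat (k + N j))) \<longlonglongrightarrow> \<beta> k) \<and> E = whole_line_cmv \<beta>)"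

definition khrushchev_class :: "((int \<Rightarrow> complex) \<Rightarrow> (int \<Rightarrow> complex)) set" where
  "khrushchev_class =
     {E. (\<exists>\<beta>. (\<forall>n. cmod (\<beta> n) \<le> 1) \<and> E = whole_line_cmv \<beta>) \<and>
         (\<exists>\<nu> :: int \<Rightarrow> complex measure.
            (\<forall>j. is_spectral_measure E (delta j) (\<nu> j)) \<and> (\<forall>n m. \<nu> n = \<nu> m))}"

end

theory Submission
  imports Defs
begin

text \<open>Applying the Laurent polynomials \<open>z powi - (n div 2) * \<phi> n\<close> (\<open>n\<close> odd) and
  \<open>z powi (n div 2) * cnj (\<phi> n)\<close> (\<open>n\<close> even) to \<open>\<C>\<close> and \<open>delta 0\<close> gives \<open>delta n\<close> up to a phase,
  because the vectors \<open>\<C> powi i\<close> applied to \<open>delta 0\<close>, in the order \<open>i = 0, 1, -1, 2, -2, \<dots>\<close>,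
  are triangular with nonzero diagonal with respect to the standard basis.  Hence the
  \<open>l\<close>-th moment of \<open>|\<phi> n|\<^sup>2 \<mu>\<close> is the \<open>n\<close>-th diagonal entry of \<open>\<C> powi l\<close>.  Diagonal entries of
  powers pass to right limits entrywise; a translation by an odd integer interchanges
  \<open>\<L>\<close> and \<open>\<M>\<close>, that is, replaces the operator by its transpose, which has the same
  diagonal.  So every diagonal entry of the \<open>l\<close>-th power of a right limit is the \<open>l\<close>-th moment
  of the weak limit of \<open>|\<phi> n|\<^sup>2 \<mu>\<close>.\<close>

section \<open>Block operators on two-sided sequences\<close>

text \<open>\<open>blocks True\<close> is \<open>whole_L\<close> and \<open>blocks False\<close> is
  \<open>whole_M\<close>. The parity is a parameter because odd translations and transposition
  exchange the two factors.\<close>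

definition blocks :: "bool \<Rightarrow> (int \<Rightarrow> complex) \<Rightarrow> (int \<Rightarrow> complex) \<Rightarrow> int \<Rightarrow> complex" where
  "blocks b \<beta> f = (\<lambda>n. if even n = b then theta_fst (\<beta> n) (f n) (f (n + 1))
                       else theta_snd (\<beta> (n - 1)) (f (n - 1)) (f n))"

definition cmv :: "bool \<Rightarrow> (int \<Rightarrow> complex) \<Rightarrow> (int \<Rightarrow> complex) \<Rightarrow> int \<Rightarrow> complex" where
  "cmv b \<beta> = blocks b \<beta> \<circ> blocks (\<not> b) \<beta>"

definition cnj_seq :: "('i \<Rightarrow> complex) \<Rightarrow> 'i \<Rightarrow> complex" where
  "cnj_seq f = (\<lambda>n. cnj (f n))"

text \<open>A block with coefficient \<open>a\<close>, \<open>cmod a \<le> 1\<close>, is unitary and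
  its adjoint is the block of \<open>cnj a\<close>; inverting the product reverses the two factors.
  Written this way, negative powers also depend entrywise continuously on
  \<open>\<beta>\<close>.\<close>

definition cmv_pow :: "bool \<Rightarrow> (int \<Rightarrow> complex) \<Rightarrow> int \<Rightarrow> (int \<Rightarrow> complex) \<Rightarrow> int \<Rightarrow> complex" where
  "cmv_pow b \<beta> l = (if l \<ge> 0 then cmv b \<beta> ^^ nat l else cmv (\<not> b) (cnj_seq \<beta>) ^^ nat (- l))"

definition finsupp :: "('i \<Rightarrow> complex) \<Rightarrow> bool" where
  "finsupp f \<longleftrightarrow> finite {n. f n \<noteq> 0}"

lemma whole_line_cmv_eq: "whole_line_cmv \<beta> = cmv True \<beta>"
  by (auto simp: whole_line_cmv_def cmv_def whole_L_def whole_M_def blocks_def fun_eq_iff)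

lemma cnj_seq_cnj_seq [simp]: "cnj_seq (cnj_seq f) = f"
  by (simp add: cnj_seq_def)

lemma cnj_seq_delta [simp]: "cnj_seq (delta k) = delta k"
  by (auto simp: cnj_seq_def delta_def)

lemma finsupp_delta [simp]: "finsupp (delta k)"
  by (simp add: finsupp_def delta_def)

lemma rho_cnj [simp]: "rho (cnj a) = rho a"
  by (simp add: rho_def)

lemma rho_sq: "cmod a \<le> 1 \<Longrightarrow> of_real (rho a) * of_real (rho a) = 1 - a * cnj a"
proof -
  assume "cmod a \<le> 1"
  then have "(cmod a)\<^sup>2 \<le> 1" by (simp add: abs_square_le_1)
  then have "rho a * rho a = 1 - (cmod a)\<^sup>2" by (simp add: rho_def)
  then show ?thesis
    by (metis complex_norm_square of_real_1 of_real_diff of_real_mult of_real_power)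
qed

lemma blocks_inverse:
  assumes "\<forall>n. cmod (\<beta> n) \<le> 1"
  shows "blocks b (cnj_seq \<beta>) (blocks b \<beta> f) = f"
proof
  fix n
  have r: "\<beta> m * (x * cnj (\<beta> m)) + x * (complex_of_real (rho (\<beta> m)) * complex_of_real (rho (\<beta> m))) = x"
    "x * (\<beta> m * cnj (\<beta> m)) + x * (complex_of_real (rho (\<beta> m)) * complex_of_real (rho (\<beta> m))) = x" for m x
    using assms by (simp_all add: rho_sq algebra_simps)
  show "blocks b (cnj_seq \<beta>) (blocks b \<beta> f) n = f n"
    by (auto simp: blocks_def cnj_seq_def theta_fst_def theta_snd_def algebra_simps r)
qed

lemma cmv_inverse:
  assumes "\<forall>n. cmod (\<beta> n) \<le> 1"
  shows "cmv (\<not> b) (cnj_seq \<beta>) (cmv b \<beta> f) = f"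
  using blocks_inverse[OF assms] by (simp add: cmv_def)

lemma cmv_inverse':
  assumes "\<forall>n. cmod (\<beta> n) \<le> 1"
  shows "cmv b \<beta> (cmv (\<not> b) (cnj_seq \<beta>) f) = f"
  using cmv_inverse[of "cnj_seq \<beta>" "\<not> b" f] assms by (simp add: cnj_seq_def)

lemma cnj_seq_blocks: "cnj_seq (blocks b \<beta> f) = blocks b (cnj_seq \<beta>) (cnj_seq f)"
  by (auto simp: blocks_def cnj_seq_def theta_fst_def theta_snd_def)

lemma cnj_seq_cmv: "cnj_seq (cmv b \<beta> f) = cmv b (cnj_seq \<beta>) (cnj_seq f)"
  by (simp add: cmv_def cnj_seq_blocks)

section \<open>Finitely supported sequences and adjoints\<close>

lemma finsupp_blocks:
  assumes "finsupp f" shows "finsupp (blocks b \<beta> f)"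
proof -
  let ?S = "{n. f n \<noteq> 0}"
  have "{n. blocks b \<beta> f n \<noteq> 0} \<subseteq> ?S \<union> (\<lambda>n. n + 1) ` ?S \<union> (\<lambda>n. n - 1) ` ?S"
  proof
    fix n assume "n \<in> {n. blocks b \<beta> f n \<noteq> 0}"
    then have "f n \<noteq> 0 \<or> f (n + 1) \<noteq> 0 \<or> f (n - 1) \<noteq> 0"
      by (auto simp: blocks_def theta_fst_def theta_snd_def split: if_splits)
    then show "n \<in> ?S \<union> (\<lambda>n. n + 1) ` ?S \<union> (\<lambda>n. n - 1) ` ?S"
      by (auto simp: image_iff algebra_simps)
  qed
  with assms show ?thesis unfolding finsupp_def
    by (meson finite_UnI finite_imageI finite_subset)
qed

lemma finsupp_cmv: "finsupp f \<Longrightarrow> finsupp (cmv b \<beta> f)"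
  by (simp add: cmv_def finsupp_blocks)

lemma finsupp_ell2: "finsupp f \<Longrightarrow> f \<in> ell2"
  unfolding finsupp_def ell2_def mem_Collect_eq
  by (rule finite_nonzero_values_imp_summable_on) simp

lemma finsupp_summable:
  assumes "finsupp f" and "\<And>n. f n = 0 \<Longrightarrow> g n = 0"
  shows "(g :: _ \<Rightarrow> complex) summable_on UNIV"
proof (rule finite_nonzero_values_imp_summable_on)
  have "{n \<in> UNIV. g n \<noteq> 0} \<subseteq> {n. f n \<noteq> 0}" using assms(2) by auto
  then show "finite {n \<in> UNIV. g n \<noteq> 0}"
    using assms(1) finite_subset unfolding finsupp_def by blast
qed

text \<open>The adjoint of each block is the block of the conjugate coefficient. The finite support
  of \<open>f\<close> makes all the sums finite, so \<open>g\<close> may be arbitrary.\<close>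

lemma ell2_inner_blocks:
  assumes "finsupp f"
  shows "ell2_inner f (blocks b \<beta> g) = ell2_inner (blocks b (cnj_seq \<beta>) f) g"
proof -
  \<comment> \<open>\<open>\<sigma>\<close> exchanges the two coordinates of each block. The
    operator is the diagonal \<open>d\<close> plus this exchange weighted by the invariant
    \<open>r\<close>; reindexing by \<open>\<sigma>\<close> carries the exchange over to
    \<open>f\<close>.\<close>
  define \<sigma> where "\<sigma> n = (if even n = b then n + 1 else n - 1)" for n :: int
  define d where "d n = (if even n = b then cnj (\<beta> n) else - \<beta> (n - 1))" for n
  define r where "r n = complex_of_real (if even n = b then rho (\<beta> n) else rho (\<beta> (n - 1)))" for n
  have \<sigma>\<sigma>: "\<sigma> (\<sigma> n) = n" for n by (auto simp: \<sigma>_def)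
  have r\<sigma>: "r (\<sigma> n) = r n" for n by (auto simp: \<sigma>_def r_def)
  have bij: "bij_betw \<sigma> UNIV UNIV"
    by (rule bij_betwI[where g=\<sigma>]) (auto simp: \<sigma>\<sigma>)
  let ?D = "\<lambda>n. cnj (f n) * (d n * g n)"
  let ?R = "\<lambda>n. cnj (f n) * (r n * g (\<sigma> n))"
  let ?R' = "\<lambda>n. r n * cnj (f (\<sigma> n)) * g n"
  have sD: "?D summable_on UNIV" and sR: "?R summable_on UNIV"
    by (rule finsupp_summable[OF assms]; simp)+
  have RR': "(\<lambda>n. ?R (\<sigma> n)) = ?R'" by (simp add: \<sigma>\<sigma> r\<sigma> mult.assoc mult.left_commute)
  have sR': "?R' summable_on UNIV"
    using sR summable_on_reindex_bij_betw[OF bij, of ?R] RR' by simp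
  have "ell2_inner f (blocks b \<beta> g) = (\<Sum>\<^sub>\<infinity>n. ?D n + ?R n)"
    unfolding ell2_inner_def
    by (rule infsum_cong)
       (auto simp: blocks_def theta_fst_def theta_snd_def d_def r_def \<sigma>_def algebra_simps)
  also have "\<dots> = infsum ?D UNIV + infsum ?R UNIV" by (rule infsum_add[OF sD sR])
  also have "infsum ?R UNIV = infsum ?R' UNIV"
    using infsum_reindex_bij_betw[OF bij, of ?R] RR' by simp
  also have "infsum ?D UNIV + infsum ?R' UNIV = (\<Sum>\<^sub>\<infinity>n. ?D n + ?R' n)"
    by (rule infsum_add[OF sD sR', symmetric])
  also have "\<dots> = ell2_inner (blocks b (cnj_seq \<beta>) f) g"
    unfolding ell2_inner_def
    by (rule infsum_cong)
       (auto simp: blocks_def theta_fst_def theta_snd_def d_def r_def \<sigma>_def cnj_seq_def algebra_simps)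
  finally show ?thesis .
qed

lemma ell2_inner_cmv:
  "finsupp f \<Longrightarrow> ell2_inner f (cmv b \<beta> g) = ell2_inner (cmv (\<not> b) (cnj_seq \<beta>) f) g"
  by (simp add: cmv_def ell2_inner_blocks finsupp_blocks)

lemma ell2_inner_delta_left [simp]: "ell2_inner (delta k) g = g k"
proof -
  have "ell2_inner (delta k) g = (\<Sum>\<^sub>\<infinity>n\<in>{k}. cnj (delta k n) * g n)"
    unfolding ell2_inner_def by (rule infsum_cong_neutral) (auto simp: delta_def)
  then show ?thesis by (simp add: delta_def)
qed

lemma ell2_inner_delta_right [simp]: "ell2_inner g (delta k) = cnj (g k)"
proof -
  have "ell2_inner g (delta k) = (\<Sum>\<^sub>\<infinity>n\<in>{k}. cnj (g n) * delta k n)"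
    unfolding ell2_inner_def by (rule infsum_cong_neutral) (auto simp: delta_def)
  then show ?thesis by (simp add: delta_def)
qed

section \<open>Integer powers\<close>

lemma funpow_cmv_finsupp: "finsupp f \<Longrightarrow> finsupp ((cmv b \<beta> ^^ n) f)"
  by (induction n) (auto simp: finsupp_cmv)

lemma finsupp_cmv_pow: "finsupp f \<Longrightarrow> finsupp (cmv_pow b \<beta> l f)"
  by (simp add: cmv_pow_def funpow_cmv_finsupp)

lemma cmv_pow_0 [simp]: "cmv_pow b \<beta> 0 = id"
  by (simp add: cmv_pow_def)

lemma cmv_pow_minus: "cmv_pow b \<beta> (- l) = cmv_pow (\<not> b) (cnj_seq \<beta>) l"
  by (auto simp: cmv_pow_def)

lemma cmv_pow_nat: "cmv_pow b \<beta> (int n) = cmv b \<beta> ^^ n"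
  by (simp add: cmv_pow_def)

lemma cmv_pow_plus1:
  assumes "\<forall>n. cmod (\<beta> n) \<le> 1"
  shows "cmv_pow b \<beta> (l + 1) f = cmv b \<beta> (cmv_pow b \<beta> l f)"
proof (cases "l \<ge> 0")
  case True
  then show ?thesis by (simp add: cmv_pow_def nat_add_distrib)
next
  case False
  then have n: "nat (- l) = Suc (nat (- (l + 1)))" by simp
  have "cmv b \<beta> (cmv_pow b \<beta> l f) = (cmv (\<not> b) (cnj_seq \<beta>) ^^ nat (- (l + 1))) f"
    using False cmv_inverse'[OF assms] by (simp add: cmv_pow_def n)
  also have "\<dots> = cmv_pow b \<beta> (l + 1) f"
  \<comment> \<open>At \<open>l = -1\<close> the exponent \<open>l + 1\<close> falls into the
    nonnegative branch of \<open>cmv_pow\<close>; both branches give the identity there.\<close>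
  proof (cases "l + 1 = 0")
    case False
    with \<open>\<not> l \<ge> 0\<close> show ?thesis by (simp add: cmv_pow_def)
  qed simp
  finally show ?thesis by simp
qed

lemma cmv_pow_add:
  assumes "\<forall>n. cmod (\<beta> n) \<le> 1"
  shows "cmv_pow b \<beta> (l + m) f = cmv_pow b \<beta> l (cmv_pow b \<beta> m f)"
proof (induction l rule: int_induct[where k=0])
  case base
  then show ?case by simp
next
  case (step1 i)
  then show ?case using cmv_pow_plus1[OF assms, of b "i + m"] cmv_pow_plus1[OF assms, of b i]
    by (simp add: algebra_simps)
next
  case (step2 i)
  \<comment> \<open>Downward step: applying the operator raises both exponents by one and gives the
    induction hypothesis; its left inverse then cancels it.\<close>
  have "cmv b \<beta> (cmv_pow b \<beta> (i - 1 + m) f) = cmv b \<beta> (cmv_pow b \<beta> (i - 1) (cmv_pow b \<beta> m f))"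
    using step2 cmv_pow_plus1[OF assms, of b "i - 1 + m"] cmv_pow_plus1[OF assms, of b "i - 1"]
    by (simp add: algebra_simps)
  then show ?case by (metis cmv_inverse[OF assms])
qed

lemma ell2_inner_funpow_cmv:
  "finsupp f \<Longrightarrow> ell2_inner f ((cmv b \<beta> ^^ n) g) = ell2_inner ((cmv (\<not> b) (cnj_seq \<beta>) ^^ n) f) g"
proof (induction n arbitrary: f g)
  case (Suc n)
  let ?T = "cmv (\<not> b) (cnj_seq \<beta>)"
  have "ell2_inner f ((cmv b \<beta> ^^ Suc n) g) = ell2_inner (?T f) ((cmv b \<beta> ^^ n) g)"
    using Suc.prems by (simp add: ell2_inner_cmv)
  also have "\<dots> = ell2_inner ((?T ^^ n) (?T f)) g"
    by (rule Suc.IH) (simp add: finsupp_cmv Suc.prems)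
  finally show ?case by (simp add: funpow_swap1)
qed simp

lemma ell2_inner_cmv_pow:
  assumes "finsupp f"
  shows "ell2_inner f (cmv_pow b \<beta> l g) = ell2_inner (cmv_pow b \<beta> (- l) f) g"
  unfolding cmv_pow_minus using assms by (auto simp: cmv_pow_def ell2_inner_funpow_cmv)

lemma cnj_seq_cmv_pow: "cnj_seq (cmv_pow b \<beta> l f) = cmv_pow b (cnj_seq \<beta>) l (cnj_seq f)"
proof -
  have "cnj_seq ((cmv b \<beta> ^^ n) f) = (cmv b (cnj_seq \<beta>) ^^ n) (cnj_seq f)" for n b \<beta>
    by (induction n) (simp_all add: cnj_seq_cmv)
  then show ?thesis by (simp add: cmv_pow_def)
qed

lemma cmv_pow_diag_minus: "cmv_pow b \<beta> (- l) (delta k) k = cnj (cmv_pow b \<beta> l (delta k) k)"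
  using ell2_inner_cmv_pow[OF finsupp_delta, of k b \<beta> "-l" "delta k"] by simp

text \<open>The operators for the two values of \<open>b\<close> are transposes of each other.\<close>

lemma cmv_pow_diag_swap: "cmv_pow b \<beta> l (delta k) k = cmv_pow (\<not> b) \<beta> l (delta k) k"
proof -
  have "cmv_pow b \<beta> l (delta k) k = cnj (cmv_pow (\<not> b) (cnj_seq \<beta>) l (delta k) k)"
    using cmv_pow_diag_minus[of b \<beta> l k] by (simp add: cmv_pow_minus)
  also have "\<dots> = cnj_seq (cmv_pow (\<not> b) (cnj_seq \<beta>) l (delta k)) k"
    by (simp add: cnj_seq_def)
  also have "\<dots> = cmv_pow (\<not> b) \<beta> l (delta k) k"
    by (simp add: cnj_seq_cmv_pow)
  finally show ?thesis .
qed

text \<open>The explicit inverse maps a finitely supported vector to a finitely supported one, hence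
  into \<open>ell2\<close>; by injectivity this is the preimage that \<open>inv_into ell2\<close>
  selects.\<close>

lemma op_powi_whole_line:
  assumes "\<forall>n. cmod (\<beta> n) \<le> 1" and "finsupp f"
  shows "op_powi (whole_line_cmv \<beta>) l f = cmv_pow True \<beta> l f"
proof (cases "l \<ge> 0")
  case True
  then show ?thesis by (simp add: op_powi_def cmv_pow_def whole_line_cmv_eq)
next
  case False
  have inv: "inv_into ell2 (cmv True \<beta>) g = cmv False (cnj_seq \<beta>) g" if "finsupp g" for g
  proof -
    have "inj_on (cmv True \<beta>) ell2"
      using cmv_inverse[OF assms(1), of True] by (metis inj_onI)
    moreover have "cmv False (cnj_seq \<beta>) g \<in> ell2"
      by (simp add: finsupp_ell2 finsupp_cmv that)
    ultimately show ?thesis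
      using cmv_inverse'[OF assms(1), of True g] by (metis (full_types) inv_into_f_f)
  qed
  have "(inv_into ell2 (cmv True \<beta>) ^^ n) f = (cmv False (cnj_seq \<beta>) ^^ n) f" for n
    using assms(2) by (induction n) (simp_all add: inv funpow_cmv_finsupp)
  then show ?thesis using False by (simp add: op_powi_def cmv_pow_def whole_line_cmv_eq)
qed

lemma blocks_sum:
  "blocks b \<beta> (\<lambda>n. \<Sum>i\<in>A. c i * f i n) = (\<lambda>n. \<Sum>i\<in>A. c i * blocks b \<beta> (f i) n)"
proof
  fix n
  show "blocks b \<beta> (\<lambda>n. \<Sum>i\<in>A. c i * f i n) n = (\<Sum>i\<in>A. c i * blocks b \<beta> (f i) n)"
    by (cases "even n = b")
       (simp_all add: blocks_def theta_fst_def theta_snd_def sum_distrib_left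
          distrib_left right_diff_distrib sum.distrib sum_subtractf mult.left_commute)
qed

lemma cmv_sum:
  "cmv b \<beta> (\<lambda>n. \<Sum>i\<in>A. c i * f i n) = (\<lambda>n. \<Sum>i\<in>A. c i * cmv b \<beta> (f i) n)"
  by (simp add: cmv_def blocks_sum)

lemma cmv_pow_sum:
  "cmv_pow b \<beta> l (\<lambda>n. \<Sum>i\<in>A. c i * f i n) = (\<lambda>n. \<Sum>i\<in>A. c i * cmv_pow b \<beta> l (f i) n)"
proof -
  have "(cmv b \<beta> ^^ m) (\<lambda>n. \<Sum>i\<in>A. c i * f i n) = (\<lambda>n. \<Sum>i\<in>A. c i * (cmv b \<beta> ^^ m) (f i) n)"
    for b \<beta> m
    by (induction m) (simp_all add: cmv_sum)
  then show ?thesis by (simp add: cmv_pow_def)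
qed

section \<open>Translations and limits\<close>

definition translate :: "int \<Rightarrow> (int \<Rightarrow> complex) \<Rightarrow> int \<Rightarrow> complex" where
  "translate N f = (\<lambda>n. f (n + N))"

lemma translate_delta: "translate N (delta (k + N)) = delta k"
  by (auto simp: translate_def delta_def)

text \<open>An odd shift exchanges even and odd starting points of blocks: \<open>b = even N\<close>
  is \<open>b\<close> for even \<open>N\<close> and its negation for odd \<open>N\<close>.\<close>

lemma blocks_translate: "blocks b (translate N \<beta>) (translate N f) = translate N (blocks (b = even N) \<beta> f)"
  by (auto simp: blocks_def translate_def fun_eq_iff algebra_simps)

lemma cmv_translate: "cmv b (translate N \<beta>) (translate N f) = translate N (cmv (b = even N) \<beta> f)"
proof -
  have "((\<not> b) = even N) = (\<not> (b = even N))" by auto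
  then show ?thesis by (simp add: cmv_def blocks_translate)
qed

lemma cmv_pow_translate:
  "cmv_pow b (translate N \<beta>) l (translate N f) = translate N (cmv_pow (b = even N) \<beta> l f)"
proof -
  have "(cmv b (translate N \<beta>) ^^ m) (translate N f) = translate N ((cmv (b = even N) \<beta> ^^ m) f)" for b \<beta> m
    by (induction m) (simp_all add: cmv_translate)
  moreover have "cnj_seq (translate N \<beta>) = translate N (cnj_seq \<beta>)"
    by (simp add: cnj_seq_def translate_def)
  moreover have "((\<not> b) = even N) = (\<not> (b = even N))" by auto
  ultimately show ?thesis by (simp add: cmv_pow_def)
qed

text \<open>An odd translation flips \<open>b\<close>, and on the diagonal the transposition flips
  it back.\<close>

lemma cmv_pow_translate_diag:
  "cmv_pow b (translate N \<beta>) l (delta k) k = cmv_pow b \<beta> l (delta (k + N)) (k + N)"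
proof -
  have "cmv_pow b (translate N \<beta>) l (delta k) k = cmv_pow (b = even N) \<beta> l (delta (k + N)) (k + N)"
    using fun_cong[OF cmv_pow_translate[of b N \<beta> l "delta (k + N)"], of k]
    unfolding translate_delta by (simp add: translate_def)
  also have "\<dots> = cmv_pow b \<beta> l (delta (k + N)) (k + N)"
    by (cases "even N"; cases b) (simp_all add: cmv_pow_diag_swap[of False])
  finally show ?thesis .
qed

lemma tendsto_blocks:
  assumes "\<And>n. (\<lambda>j. \<beta>s j n) \<longlonglongrightarrow> \<beta> n" and "\<And>n. (\<lambda>j. fs j n) \<longlonglongrightarrow> f n"
  shows "(\<lambda>j. blocks b (\<beta>s j) (fs j) n) \<longlonglongrightarrow> blocks b \<beta> f n"
  unfolding blocks_def theta_fst_def theta_snd_def rho_def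
  by (auto intro!: tendsto_intros assms)

text \<open>An entry of a power involves only finitely many coefficients, through continuous
  expressions, so pointwise convergence of the coefficients suffices.\<close>

lemma tendsto_cmv_pow:
  assumes "\<And>n. (\<lambda>j. \<beta>s j n) \<longlonglongrightarrow> \<beta> n"
  shows "(\<lambda>j. cmv_pow b (\<beta>s j) l f n) \<longlonglongrightarrow> cmv_pow b \<beta> l f n"
proof -
  have *: "(\<lambda>j. (cmv b (\<beta>s j) ^^ m) f n) \<longlonglongrightarrow> (cmv b \<beta> ^^ m) f n"
    if "\<And>n. (\<lambda>j. \<beta>s j n) \<longlonglongrightarrow> \<beta> n" for b \<beta>s \<beta> m n
    by (induction m arbitrary: n) (auto simp: cmv_def intro!: tendsto_blocks that)
  have "(\<lambda>j. cnj_seq (\<beta>s j) n) \<longlonglongrightarrow> cnj_seq \<beta> n" for n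
    unfolding cnj_seq_def by (intro tendsto_cnj assms)
  with * assms show ?thesis unfolding cmv_pow_def by (cases "l \<ge> 0") simp_all
qed

section \<open>The half-line operator inside a whole-line operator\<close>

text \<open>The value \<open>-1\<close> makes all blocks on negative coordinates diagonal and the block on
  the coordinates \<open>-1, 0\<close> act as the identity at \<open>0\<close>.\<close>

definition extend :: "(nat \<Rightarrow> complex) \<Rightarrow> int \<Rightarrow> complex" where
  "extend \<alpha> = (\<lambda>k. if k \<ge> 0 then \<alpha> (nat k) else - 1)"

definition embed :: "(nat \<Rightarrow> complex) \<Rightarrow> int \<Rightarrow> complex" where
  "embed f = (\<lambda>k. if k \<ge> 0 then f (nat k) else 0)"

lemma rho_minus_one [simp]: "rho (- 1) = 0"
  by (simp add: rho_def)

lemma embed_half_L: "embed (half_L \<alpha> f) = blocks True (extend \<alpha>) (embed f)"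
proof
  fix n :: int
  show "embed (half_L \<alpha> f) n = blocks True (extend \<alpha>) (embed f) n"
  proof (cases "n \<ge> 0")
    case True
    then obtain m where n: "n = int m" by (metis nat_0_le)
    show ?thesis
    proof (cases "even m")
      case True
      then show ?thesis by (simp add: n embed_def half_L_def blocks_def extend_def nat_add_distrib)
    next
      case False
      then obtain k where "m = Suc k" by (cases m) auto
      moreover have "nat (1 + int k) = Suc k" by simp
      ultimately show ?thesis using False
        by (simp add: n embed_def half_L_def blocks_def extend_def)
    qed
  next
    case False
    \<comment> \<open>No block of this factor joins \<open>-1\<close> to \<open>0\<close>, since its
      blocks start at even coordinates.\<close>
    then have "even n \<Longrightarrow> n + 1 < 0" by presburger
    with False show ?thesis
      by (auto simp: embed_def blocks_def theta_fst_def theta_snd_def)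
  qed
qed

lemma embed_half_M: "embed (half_M \<alpha> f) = blocks False (extend \<alpha>) (embed f)"
proof
  fix n :: int
  show "embed (half_M \<alpha> f) n = blocks False (extend \<alpha>) (embed f) n"
  proof (cases "n \<ge> 0")
    case True
    then obtain m where n: "n = int m" by (metis nat_0_le)
    show ?thesis
    proof (cases "odd m")
      case True
      then show ?thesis
        by (auto simp: n embed_def half_M_def blocks_def extend_def nat_add_distrib)
    next
      case False
      moreover have "nat (1 + int k) = Suc k" for k by simp
      ultimately show ?thesis
        by (cases m) (simp_all add: n embed_def half_M_def blocks_def extend_def theta_snd_def)
    qed
  next
    case False
    then show ?thesis
      by (auto simp: embed_def blocks_def theta_fst_def theta_snd_def extend_def)
  qed
qed

lemma embed_half_line_cmv: "embed (half_line_cmv \<alpha> f) = cmv True (extend \<alpha>) (embed f)"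
  by (simp add: half_line_cmv_def cmv_def embed_half_L embed_half_M)

lemma embed_delta: "embed (delta 0) = delta 0"
  by (auto simp: embed_def delta_def fun_eq_iff)

lemma half_line_cmv_pow:
  "(half_line_cmv \<alpha> ^^ n) (delta 0) 0 = cmv_pow True (extend \<alpha>) (int n) (delta 0) 0"
proof -
  have "embed ((half_line_cmv \<alpha> ^^ n) (delta 0)) = (cmv True (extend \<alpha>) ^^ n) (delta 0)"
    by (induction n) (simp_all add: embed_half_line_cmv embed_delta)
  from fun_cong[OF this, of 0] show ?thesis by (simp add: cmv_pow_nat embed_def)
qed

section \<open>Integration on the unit circle and moments of \<open>\<mu>\<close>\<close>

lemma norm_one_powi_minus:
  fixes z :: complex
  assumes "norm z = 1" shows "z powi (- l) = cnj (z powi l)"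
  using divide_conv_cnj[of "z powi l" 1] assms
  by (simp add: power_int_minus divide_inverse norm_power_int)

lemma space_circle: "sets \<mu> = sets circle_algebra \<Longrightarrow> space \<mu> = sphere 0 1"
  using sets_eq_imp_space_eq[of \<mu> circle_algebra]
  by (simp add: circle_algebra_def space_restrict_space)

lemma borel_measurable_circle:
  assumes "sets \<mu> = sets circle_algebra" and "continuous_on (sphere 0 1) f"
  shows "(f :: complex \<Rightarrow> 'a :: topological_space) \<in> borel_measurable \<mu>"
  by (subst measurable_cong_sets[OF assms(1) refl])
     (simp add: circle_algebra_def borel_measurable_continuous_on_restrict assms(2))

lemma integrable_circle:
  fixes f :: "complex \<Rightarrow> complex"
  assumes "sets \<mu> = sets circle_algebra" and "finite_measure \<mu>" and "continuous_on (sphere 0 1) f"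
  shows "integrable \<mu> f"
proof -
  have "compact (f ` sphere 0 1)" using assms(3) by (intro compact_continuous_image) auto
  then obtain B where "\<forall>x\<in>f ` sphere 0 1. norm x \<le> B"
    using compact_imp_bounded bounded_iff by metis
  then have "AE x in \<mu>. norm (f x) \<le> B"
    by (intro AE_I2) (auto simp: space_circle[OF assms(1)])
  then show ?thesis
    using finite_measure.integrable_const_bound[OF assms(2)] borel_measurable_circle[OF assms(1,3)]
    by blast
qed

text \<open>Nonnegative powers are read off through the embedding. For negative ones both sides are
  complex conjugates of the positive case, so the inverse of the half-line operator never has to be
  computed.\<close>

lemma half_line_moments:
  assumes "is_spectral_measure (half_line_cmv \<alpha>) (delta 0) \<mu>"
  shows "(\<integral>z. z powi l \<partial>\<mu>) = cmv_pow True (extend \<alpha>) l (delta 0) 0"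
proof -
  have pos: "(\<integral>z. z powi int n \<partial>\<mu>) = cmv_pow True (extend \<alpha>) (int n) (delta 0) 0" for n
  proof -
    have "(\<integral>z. z powi int n \<partial>\<mu>)
      = ell2_inner (delta 0) (op_powi (half_line_cmv \<alpha>) (int n) (delta 0))"
      using assms unfolding is_spectral_measure_def by blast
    then show ?thesis by (simp add: op_powi_def half_line_cmv_pow del: power_int_of_nat)
  qed
  show ?thesis
  proof (cases "l \<ge> 0")
    case True
    with pos[of "nat l"] show ?thesis by simp
  next
    case False
    define n where "n = nat (- l)"
    have l: "l = - int n" using False by (simp add: n_def)
    have "(\<integral>z. z powi l \<partial>\<mu>) = (\<integral>z. cnj (z powi int n) \<partial>\<mu>)"
      unfolding l using assms
      by (intro Bochner_Integration.integral_cong refl norm_one_powi_minus)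
         (simp add: is_spectral_measure_def space_circle)
    also have "\<dots> = cnj (\<integral>z. z powi int n \<partial>\<mu>)" by (rule Bochner_Integration.integral_cnj)
    finally show ?thesis by (simp only: pos l cmv_pow_diag_minus)
  qed
qed

section \<open>The triangular structure of the orbit of \<open>delta 0\<close>\<close>

definition top_at :: "int \<Rightarrow> (int \<Rightarrow> complex) \<Rightarrow> bool" where
  "top_at n f \<longleftrightarrow> (\<forall>m. m < 0 \<or> m > n \<longrightarrow> f m = 0) \<and> f n \<noteq> 0"

text \<open>The position of \<open>i\<close> in the enumeration \<open>0, 1, -1, 2, -2, ...\<close>
  of the integers; it is also the last coordinate reached by the \<open>i\<close>-th power applied
  to \<open>delta 0\<close>.\<close>

definition level :: "int \<Rightarrow> int" where
  "level i = (if i > 0 then 2 * i - 1 else - 2 * i)"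

lemma level_surj: "m \<ge> 0 \<Longrightarrow> \<exists>i. level i = m"
  unfolding level_def
  by (rule exI[of _ "if odd m then (m + 1) div 2 else - (m div 2)"]) (auto; presburger)

lemma level_eq_iff: "level i = level j \<longleftrightarrow> i = j"
  unfolding level_def by (auto; presburger)

text \<open>The last nonzero coordinate \<open>n\<close> opens a block, whose off-diagonal entry
  \<open>rho (\<beta> n)\<close> is nonzero and pushes it one step to the right.\<close>

lemma top_at_blocks:
  assumes "top_at n f" and "0 \<le> n" and "even n = b" and "cmod (\<beta> n) < 1" and "rho (\<beta> (- 1)) = 0"
  shows "top_at (n + 1) (blocks b \<beta> f)"
proof -
  have "(cmod (\<beta> n))\<^sup>2 < 1" using assms(4) by (simp add: abs_square_less_1)
  then have "rho (\<beta> n) \<noteq> 0" by (simp add: rho_def)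
  then have "blocks b \<beta> f (n + 1) \<noteq> 0"
    using assms(1,3) by (auto simp: blocks_def theta_snd_def top_at_def)
  moreover have "blocks b \<beta> f m = 0" if "m < 0 \<or> m > n + 1" for m
  \<comment> \<open>Only the block on \<open>-1, 0\<close> could carry \<open>f 0\<close> to a
    negative coordinate; its off-diagonal entry is \<open>rho (\<beta> (- 1)) = 0\<close>.\<close>
  proof (cases "m = - 1 \<and> even m = b")
    case True
    with assms(1,2,5) show ?thesis by (auto simp: blocks_def theta_fst_def top_at_def)
  next
    case False
    with that assms(1,2) show ?thesis
      by (auto simp: blocks_def theta_fst_def theta_snd_def top_at_def)
  qed
  ultimately show ?thesis by (simp add: top_at_def)
qed

text \<open>Consequently the first positive power advances \<open>delta 0\<close> by one coordinate
  only, while every later one advances the last coordinate by two.\<close>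

lemma blocks_delta_0: "\<beta> (- 1) = - 1 \<Longrightarrow> blocks False \<beta> (delta 0) = delta 0"
  by (auto simp: blocks_def delta_def theta_fst_def theta_snd_def fun_eq_iff
      eq_neg_iff_add_eq_0[symmetric])

text \<open>The half-line operator enters from here on only through its extension
  \<open>\<beta>\<close> and the moments of \<open>\<mu>\<close>.\<close>

locale half_line =
  fixes \<beta> :: "int \<Rightarrow> complex" and \<mu> :: "complex measure"
  assumes bounded: "\<forall>n. cmod (\<beta> n) \<le> 1"
    and strict: "\<And>n. n \<ge> 0 \<Longrightarrow> cmod (\<beta> n) < 1"
    and minus_one: "\<beta> (- 1) = - 1"
    and sets_\<mu>: "sets \<mu> = sets circle_algebra"
    and finite_\<mu>: "finite_measure \<mu>"
    and moments: "(\<integral>z. z powi l \<partial>\<mu>) = cmv_pow True \<beta> l (delta 0) 0"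
begin

abbreviation orbit :: "int \<Rightarrow> int \<Rightarrow> complex" where
  "orbit i \<equiv> cmv_pow True \<beta> i (delta 0)"

text \<open>From an odd last coordinate the factor with odd blocks acts first and moves it to an
  even one, then the factor with even blocks moves it on.\<close>

lemma top_at_orbit_pos: "top_at (2 * int k + 1) (orbit (int k + 1))"
proof (induction k)
  case 0
  have "top_at 0 (delta 0)" by (simp add: top_at_def delta_def)
  then have "top_at 1 (blocks True \<beta> (delta 0))"
    using top_at_blocks[of 0 "delta 0" True \<beta>] strict minus_one by simp
  then show ?case using cmv_pow_nat[of True \<beta> 1] by (simp add: cmv_def blocks_delta_0 minus_one)
next
  case (Suc k)
  have "top_at (2 * int k + 2) (blocks False \<beta> (orbit (int k + 1)))"
    using top_at_blocks[OF Suc, of False \<beta>] strict minus_one by (simp add: add.commute)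
  then have "top_at (2 * int k + 3) (blocks True \<beta> (blocks False \<beta> (orbit (int k + 1))))"
    using top_at_blocks[of "2 * int k + 2" _ True \<beta>] strict minus_one by (simp add: add.commute)
  then show ?case
    using cmv_pow_plus1[OF bounded, of True "int k + 1" "delta 0"]
    by (simp add: cmv_def algebra_simps)
qed

text \<open>The inverse applies the even blocks first, which suits the even last coordinates;
  already the first step from \<open>delta 0\<close> gains two.\<close>

lemma top_at_orbit_neg: "top_at (2 * int k) (orbit (- int k))"
proof (induction k)
  case 0
  show ?case by (simp add: top_at_def delta_def)
next
  case (Suc k)
  have *: "cmod (cnj_seq \<beta> n) < 1" if "n \<ge> 0" for n using strict that by (simp add: cnj_seq_def)
  have **: "rho (cnj_seq \<beta> (- 1)) = 0" using minus_one by (simp add: cnj_seq_def)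
  have "top_at (2 * int k + 1) (blocks True (cnj_seq \<beta>) (orbit (- int k)))"
    using top_at_blocks[OF Suc, of True "cnj_seq \<beta>"] * ** by simp
  then have "top_at (2 * int k + 2) (blocks False (cnj_seq \<beta>) (blocks True (cnj_seq \<beta>) (orbit (- int k))))"
    using top_at_blocks[of "2 * int k + 1" _ False "cnj_seq \<beta>"] * ** by (simp add: add.commute)
  also have "blocks False (cnj_seq \<beta>) (blocks True (cnj_seq \<beta>) (orbit (- int k))) = orbit (- int (Suc k))"
    unfolding cmv_pow_minus by (simp add: cmv_pow_nat cmv_def del: of_nat_Suc)
  finally show ?case by (simp add: algebra_simps)
qed

lemma top_at_orbit: "top_at (level i) (orbit i)"
proof (cases "i > 0")
  case True
  with top_at_orbit_pos[of "nat (i - 1)"] show ?thesis by (simp add: level_def algebra_simps)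
next
  case False
  with top_at_orbit_neg[of "nat (- i)"] show ?thesis by (simp add: level_def)
qed

lemma finsupp_orbit: "finsupp (orbit i)"
  by (simp add: finsupp_cmv_pow)

text \<open>Moving one power across by the adjoint leaves a moment of \<open>\<mu>\<close>. So
  \<open>z powi i \<mapsto> orbit i\<close> preserves inner products between the Laurent polynomials
  in \<open>L^2\<close> of \<open>\<mu>\<close> and \<open>ell2\<close>.\<close>

lemma ell2_inner_orbit: "ell2_inner (orbit i) (orbit j) = (\<integral>z. z powi (j - i) \<partial>\<mu>)"
proof -
  have "ell2_inner (orbit i) (orbit j) = ell2_inner (delta 0) (cmv_pow True \<beta> (- i) (orbit j))"
    using ell2_inner_cmv_pow[OF finsupp_delta, of 0 True \<beta> "- i" "orbit j"] by simp
  also have "\<dots> = orbit (j - i) 0"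
    using cmv_pow_add[OF bounded, of True "- i" j "delta 0"] by simp
  finally show ?thesis by (simp add: moments)
qed

end

section \<open>Laurent polynomials and combinations of orbit vectors\<close>

lemma infsum_sum_finite:
  fixes f :: "'i \<Rightarrow> 'j \<Rightarrow> complex"
  assumes "finite A" and "\<And>i. i \<in> A \<Longrightarrow> f i summable_on S"
  shows "infsum (\<lambda>n. \<Sum>i\<in>A. f i n) S = (\<Sum>i\<in>A. infsum (f i) S)"
proof -
  have "infsum (\<lambda>n. \<Sum>i\<in>A. f i n) S = (\<Sum>i\<in>A. infsum (f i) S) \<and> (\<lambda>n. \<Sum>i\<in>A. f i n) summable_on S"
    using assms by (induction A rule: finite_induct) (auto simp: infsum_add summable_on_add)
  then show ?thesis ..
qed

lemma ell2_inner_sum: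
  assumes "finite A" "finite B" "\<And>i. finsupp (f i)"
  shows "ell2_inner (\<lambda>n. \<Sum>i\<in>A. c i * f i n) (\<lambda>n. \<Sum>j\<in>B. d j * g j n)
    = (\<Sum>i\<in>A. \<Sum>j\<in>B. cnj (c i) * d j * ell2_inner (f i) (g j))"
proof -
  have s: "(\<lambda>n. cnj (c i) * d j * (cnj (f i n) * g j n)) summable_on UNIV" for i j
    by (rule finsupp_summable[OF assms(3)[of i]]) simp
  have s': "(\<lambda>n. \<Sum>j\<in>B. cnj (c i) * d j * (cnj (f i n) * g j n)) summable_on UNIV" for i
    by (rule finsupp_summable[OF assms(3)[of i]]) simp
  have "ell2_inner (\<lambda>n. \<Sum>i\<in>A. c i * f i n) (\<lambda>n. \<Sum>j\<in>B. d j * g j n)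
    = (\<Sum>\<^sub>\<infinity>n. \<Sum>i\<in>A. \<Sum>j\<in>B. cnj (c i) * d j * (cnj (f i n) * g j n))"
    unfolding ell2_inner_def cnj_sum sum_product by (simp add: mult_ac)
  also have "\<dots> = (\<Sum>i\<in>A. \<Sum>j\<in>B. \<Sum>\<^sub>\<infinity>n. cnj (c i) * d j * (cnj (f i n) * g j n))"
    by (simp add: infsum_sum_finite assms s s')
  also have "\<dots> = (\<Sum>i\<in>A. \<Sum>j\<in>B. cnj (c i) * d j * ell2_inner (f i) (g j))"
    by (simp add: ell2_inner_def infsum_cmult_right')
  finally show ?thesis .
qed

context half_line
begin

text \<open>The same isometry for finite combinations, with multiplication by
  \<open>z powi l\<close> corresponding to the \<open>l\<close>-th power of the operator.\<close>

lemma ell2_inner_orbit_sum: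
  assumes "finite A" "finite B"
  shows "ell2_inner (\<lambda>n. \<Sum>i\<in>A. c i * orbit i n) (\<lambda>n. \<Sum>j\<in>B. d j * orbit (l + j) n)
    = (\<integral>z. cnj (\<Sum>i\<in>A. c i * z powi i) * z powi l * (\<Sum>j\<in>B. d j * z powi j) \<partial>\<mu>)"
proof -
  have int: "integrable \<mu> (\<lambda>z. a * z powi m)" for m a
    by (rule integrable_circle[OF sets_\<mu> finite_\<mu>]) (auto intro!: continuous_intros)
  have "ell2_inner (\<lambda>n. \<Sum>i\<in>A. c i * orbit i n) (\<lambda>n. \<Sum>j\<in>B. d j * orbit (l + j) n)
    = (\<Sum>i\<in>A. \<Sum>j\<in>B. cnj (c i) * d j * (\<integral>z. z powi (l + j - i) \<partial>\<mu>))"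
    using ell2_inner_sum[OF assms, of orbit c d "\<lambda>j. orbit (l + j)"] finsupp_orbit
    by (simp add: ell2_inner_orbit)
  also have "\<dots> = (\<integral>z. (\<Sum>i\<in>A. \<Sum>j\<in>B. cnj (c i) * d j * z powi (l + j - i)) \<partial>\<mu>)"
    using int by (simp add: Bochner_Integration.integral_sum)
  also have "\<dots> = (\<integral>z. cnj (\<Sum>i\<in>A. c i * z powi i) * z powi l * (\<Sum>j\<in>B. d j * z powi j) \<partial>\<mu>)"
  proof (intro Bochner_Integration.integral_cong refl)
    fix z assume "z \<in> space \<mu>"
    then have z: "norm z = 1" by (simp add: space_circle[OF sets_\<mu>])
    then have z0: "z \<noteq> 0" by auto
    have "z powi (l + j - i) = cnj (z powi i) * z powi l * z powi j" for i j
    proof -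
      have "z powi (l + j - i) = z powi ((- i) + l + j)" by (simp add: algebra_simps)
      also have "\<dots> = z powi (- i) * z powi l * z powi j" using z0 by (simp only: power_int_add simp_thms)
      finally show ?thesis using norm_one_powi_minus[OF z, of i] by simp
    qed
    then show "(\<Sum>i\<in>A. \<Sum>j\<in>B. cnj (c i) * d j * z powi (l + j - i)) =
      cnj (\<Sum>i\<in>A. c i * z powi i) * z powi l * (\<Sum>j\<in>B. d j * z powi j)"
      by (simp add: sum_distrib_left sum_distrib_right algebra_simps sum.swap[of _ B A])
  qed
  finally show ?thesis .
qed

text \<open>By triangularity, orthogonality to the orbit vectors of levels
  \<open>0, 1, ..., n - 1\<close> removes the entries of \<open>y\<close> below \<open>n\<close> one
  after another.\<close>

lemma orthogonal_imp_delta: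
  assumes "\<And>m. m < 0 \<or> m > n \<Longrightarrow> y m = 0"
    and "\<And>i. level i < n \<Longrightarrow> ell2_inner (orbit i) y = 0"
  shows "y = (\<lambda>m. y n * delta n m)"
proof -
  have "\<forall>m. int m < n \<longrightarrow> y (int m) = 0"
  proof (intro allI impI)
    fix m assume "int m < n"
    then show "y (int m) = 0"
    proof (induction m rule: less_induct)
      case (less m)
      obtain i where i: "level i = int m" using level_surj[of "int m"] by auto
      \<comment> \<open>Above \<open>m\<close> the orbit vector vanishes, below \<open>m\<close> the
        induction hypothesis kills \<open>y\<close>; one term of the inner product survives.\<close>
      have zero: "cnj (orbit i k) * y k = 0" if "k \<noteq> int m" for k
      proof (cases "k < 0 \<or> k > int m")
        case True
        then show ?thesis using top_at_orbit[of i] by (auto simp: top_at_def i)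
      next
        case False
        then have "nat k < m" and "k \<ge> 0" using that by auto
        with less.IH[of "nat k"] less.prems show ?thesis by simp
      qed
      have "0 = ell2_inner (orbit i) y" using assms(2)[of i] less.prems i by simp
      also have "\<dots> = (\<Sum>\<^sub>\<infinity>k\<in>{int m}. cnj (orbit i k) * y k)"
        unfolding ell2_inner_def by (rule infsum_cong_neutral) (use zero in auto)
      finally have "cnj (orbit i (int m)) * y (int m) = 0" by simp
      with top_at_orbit[of i] i show ?case by (simp add: top_at_def)
    qed
  qed
  then have "y m = 0" if "m \<noteq> n" for m
    using that assms(1)[of m] by (cases "m < 0 \<or> m > n") (auto dest!: spec[of _ "nat m"])
  then show ?thesis by (auto simp: delta_def fun_eq_iff)
qed

text \<open>A Laurent polynomial of level \<open>n\<close> orthogonal to all lower levels represents, when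
  applied to the operator and \<open>delta 0\<close>, a nonzero multiple of \<open>delta n\<close>.\<close>

lemma orthogonal_density:
  assumes "finite A" and "\<And>i. i \<in> A \<Longrightarrow> level i \<le> n" and "p \<in> A" and "level p = n" and "c p \<noteq> 0"
    and g: "\<And>z. norm z = 1 \<Longrightarrow> g z = (\<Sum>i\<in>A. c i * z powi i)"
    and orth: "\<And>i. level i < n \<Longrightarrow> (\<integral>z. cnj (z powi i) * g z \<partial>\<mu>) = 0"
  shows "\<exists>C>0. \<forall>l. (\<integral>z. z powi l * of_real ((cmod (g z))\<^sup>2) \<partial>\<mu>)
    = of_real C * cmv_pow True \<beta> l (delta n) n"
proof -
  define y where "y = (\<lambda>m. \<Sum>i\<in>A. c i * orbit i m)"
  have gs: "g z = (\<Sum>i\<in>A. c i * z powi i)" if "z \<in> space \<mu>" for z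
    using that g by (simp add: space_circle[OF sets_\<mu>])
  have supp: "y m = 0" if "m < 0 \<or> m > n" for m
    unfolding y_def
  proof (rule sum.neutral, rule ballI)
    fix i assume "i \<in> A"
    with that assms(2)[of i] top_at_orbit[of i] show "c i * orbit i m = 0"
      by (auto simp: top_at_def)
  qed
  \<comment> \<open>Since \<open>level\<close> is injective, \<open>p\<close> is the only index in
    \<open>A\<close> whose orbit vector has a nonzero entry at \<open>n\<close>.\<close>
  have yn: "y n \<noteq> 0"
  proof -
    have "orbit i n = 0" if "i \<in> A - {p}" for i
    proof -
      have "level i \<noteq> n" using that level_eq_iff[of i p] assms(4) by auto
      with that assms(2)[of i] top_at_orbit[of i] show ?thesis by (auto simp: top_at_def)
    qed
    then have "y n = c p * orbit p n"
      unfolding y_def using assms(1,3) by (simp add: sum.remove)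
    with top_at_orbit[of p] assms(4,5) show ?thesis by (simp add: top_at_def)
  qed
  have orthy: "ell2_inner (orbit i) y = 0" if "level i < n" for i
  proof -
    have "ell2_inner (orbit i) y
      = (\<integral>z. cnj (\<Sum>i\<in>{i}. 1 * z powi i) * z powi 0 * (\<Sum>j\<in>A. c j * z powi j) \<partial>\<mu>)"
      using ell2_inner_orbit_sum[of "{i}" A "\<lambda>_. 1" c 0] assms(1) by (simp add: y_def)
    also have "\<dots> = (\<integral>z. cnj (z powi i) * g z \<partial>\<mu>)"
      by (intro Bochner_Integration.integral_cong refl) (simp add: gs)
    finally show ?thesis using orth[OF that] by simp
  qed
  have yd: "y = (\<lambda>m. \<Sum>i\<in>{n}. y n * delta i m)"
    using orthogonal_imp_delta[OF supp orthy] by simp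
  have "(\<integral>z. z powi l * of_real ((cmod (g z))\<^sup>2) \<partial>\<mu>)
    = of_real ((cmod (y n))\<^sup>2) * cmv_pow True \<beta> l (delta n) n" for l
  proof -
    have "(\<integral>z. z powi l * of_real ((cmod (g z))\<^sup>2) \<partial>\<mu>)
      = (\<integral>z. cnj (\<Sum>i\<in>A. c i * z powi i) * z powi l * (\<Sum>j\<in>A. c j * z powi j) \<partial>\<mu>)"
    proof (intro Bochner_Integration.integral_cong refl)
      fix z assume "z \<in> space \<mu>"
      then show "z powi l * of_real ((cmod (g z))\<^sup>2) =
          cnj (\<Sum>i\<in>A. c i * z powi i) * z powi l * (\<Sum>j\<in>A. c j * z powi j)"
        unfolding gs[symmetric, OF \<open>z \<in> space \<mu>\<close>] complex_norm_square by (simp add: mult_ac)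
    qed
    also have "\<dots> = ell2_inner y (\<lambda>m. \<Sum>j\<in>A. c j * orbit (l + j) m)"
      unfolding y_def using ell2_inner_orbit_sum[of A A c c l] assms(1) by simp
    also have "(\<lambda>m. \<Sum>j\<in>A. c j * orbit (l + j) m) = cmv_pow True \<beta> l y"
      unfolding y_def cmv_pow_sum by (simp add: cmv_pow_add[OF bounded])
    also have "ell2_inner y (cmv_pow True \<beta> l y) =
       ell2_inner (\<lambda>m. \<Sum>i\<in>{n}. y n * delta i m) (\<lambda>m. \<Sum>i\<in>{n}. y n * cmv_pow True \<beta> l (delta i) m)"
      using yd cmv_pow_sum[of True \<beta> l "\<lambda>_. y n" delta "{n}"] by metis
    also have "\<dots> = (\<Sum>i\<in>{n}. \<Sum>j\<in>{n}. cnj (y n) * y n * ell2_inner (delta i) (cmv_pow True \<beta> l (delta j)))"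
      by (rule ell2_inner_sum) auto
    also have "\<dots> = of_real ((cmod (y n))\<^sup>2) * cmv_pow True \<beta> l (delta n) n"
      unfolding complex_norm_square by (simp add: mult_ac)
    finally show ?thesis .
  qed
  moreover have "(cmod (y n))\<^sup>2 > 0" using yn by simp
  ultimately show ?thesis by blast
qed

end

section \<open>Orthogonal polynomials\<close>

context half_line
begin

text \<open>Induction on \<open>m\<close>, removing the top coefficient with a multiple of
  \<open>\<Phi> m\<close>. Bounding the nonzero coefficients rather than the degree lets the
  induction start at the zero polynomial.\<close>

lemma monic_orthogonal_lower_degree:
  assumes "monic_orthogonal_polys \<mu> \<Phi>" and "\<And>i. i \<ge> m \<Longrightarrow> coeff q i = 0" and "m \<le> n"
  shows "(\<integral>z. cnj (poly q z) * poly (\<Phi> n) z \<partial>\<mu>) = 0"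
  using assms(2,3)
proof (induction m arbitrary: q)
  case 0
  then have "q = 0" by (intro poly_eqI) simp
  then show ?case by simp
next
  case (Suc m)
  have deg: "degree (\<Phi> m) = m" and lc: "coeff (\<Phi> m) m = 1"
    using assms(1) unfolding monic_orthogonal_polys_def by metis+
  define r where "r = q - smult (coeff q m) (\<Phi> m)"
  have "coeff r i = 0" if "i \<ge> m" for i
  proof (cases "i = m")
    case True
    then show ?thesis by (simp add: r_def lc)
  next
    case False
    with that Suc.prems(1)[of i] deg show ?thesis by (simp add: r_def coeff_eq_0)
  qed
  with Suc have r: "(\<integral>z. cnj (poly r z) * poly (\<Phi> n) z \<partial>\<mu>) = 0" by simp
  have int: "integrable \<mu> (\<lambda>z. cnj (poly p z) * poly p' z)" for p p'
    by (rule integrable_circle[OF sets_\<mu> finite_\<mu>]) (intro continuous_intros)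
  have "(\<integral>z. cnj (poly q z) * poly (\<Phi> n) z \<partial>\<mu>)
    = (\<integral>z. cnj (poly r z) * poly (\<Phi> n) z
        + cnj (coeff q m) * (cnj (poly (\<Phi> m) z) * poly (\<Phi> n) z) \<partial>\<mu>)"
    by (rule Bochner_Integration.integral_cong) (simp_all add: r_def algebra_simps)
  also have "\<dots> = 0 + cnj (coeff q m) * (\<integral>z. cnj (poly (\<Phi> m) z) * poly (\<Phi> n) z \<partial>\<mu>)"
    using r int by simp
  also have "\<dots> = 0"
    using assms(1) Suc.prems(2) by (simp add: monic_orthogonal_polys_def)
  finally show ?case .
qed

lemma monic_orthogonal_powi:
  assumes "monic_orthogonal_polys \<mu> \<Phi>" and "0 \<le> m" and "m < int n"
  shows "(\<integral>z. cnj (z powi m) * poly (\<Phi> n) z \<partial>\<mu>) = 0"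
proof -
  have "(\<integral>z. cnj (poly (monom 1 (nat m)) z) * poly (\<Phi> n) z \<partial>\<mu>) = 0"
    using assms by (intro monic_orthogonal_lower_degree[where m="Suc (nat m)"]) auto
  with assms(2) show ?thesis by (simp add: poly_monom power_int_def)
qed

lemma monic_orthogonal_density:
  assumes \<Phi>: "monic_orthogonal_polys \<mu> \<Phi>"
  shows "\<exists>C>0. \<forall>l. (\<integral>z. z powi l * of_real ((cmod (poly (\<Phi> n) z))\<^sup>2) \<partial>\<mu>)
    = of_real C * cmv_pow True \<beta> l (delta (int n)) (int n)"
proof -
  have deg: "degree (\<Phi> n) = n" and lc: "coeff (\<Phi> n) n = 1"
    using \<Phi> unfolding monic_orthogonal_polys_def by metis+
  \<comment> \<open>The exponents of level at most \<open>n\<close> are exactly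
    \<open>-k, ..., k'\<close>. They are \<open>n + 1\<close> in number, as are the coefficients of
    \<open>\<Phi> n\<close>.\<close>
  define k where "k = int n div 2"
  define k' where "k' = (int n + 1) div 2"
  have kk: "k + k' = int n" "k \<ge> 0" "k' \<ge> 0" unfolding k_def k'_def by presburger+
  have lev: "level i \<le> int n" if "i \<in> {- k..k'}" for i
    using that unfolding level_def k_def k'_def by auto
  have alt: "poly (\<Phi> n) z = (\<Sum>i\<le>n. coeff (\<Phi> n) i * z ^ i)" for z
    using poly_altdef[of "\<Phi> n" z] by (simp add: deg)
  \<comment> \<open>The parity of \<open>n\<close> decides which Laurent polynomial \<open>g\<close>
    is used; only its modulus on the circle enters the density.\<close>
  have "\<exists>g. (\<forall>z. norm z = 1 \<longrightarrow> cmod (g z) = cmod (poly (\<Phi> n) z)) \<and>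
    (\<exists>C>0. \<forall>l. (\<integral>z. z powi l * of_real ((cmod (g z))\<^sup>2) \<partial>\<mu>)
      = of_real C * cmv_pow True \<beta> l (delta (int n)) (int n))"
  proof (cases "odd n")
    case True
    define c where "c i = coeff (\<Phi> n) (nat (i + k))" for i
    define g where "g z = z powi (- k) * poly (\<Phi> n) z" for z
    have "\<exists>C>0. \<forall>l. (\<integral>z. z powi l * of_real ((cmod (g z))\<^sup>2) \<partial>\<mu>)
      = of_real C * cmv_pow True \<beta> l (delta (int n)) (int n)"
    proof (rule orthogonal_density[where A="{- k..k'}" and c=c and p=k'])
      show "level k' = int n" using True unfolding level_def k'_def by (auto; presburger)
      show "c k' \<noteq> 0" using kk lc by (simp add: c_def add.commute)
      show "k' \<in> {- k..k'}" using kk by simp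
    next
      fix z :: complex assume "norm z = 1"
      then have z: "z \<noteq> 0" by auto
      have "g z = (\<Sum>j\<le>n. coeff (\<Phi> n) j * z powi (int j - k))"
        unfolding g_def alt sum_distrib_left using z
        by (simp add: power_int_diff power_int_minus divide_inverse mult_ac)
      also have "\<dots> = (\<Sum>i\<in>{- k..k'}. c i * z powi i)"
        by (rule sum.reindex_bij_witness[of _ "\<lambda>i. nat (i + k)" "\<lambda>j. int j - k"])
           (use kk in \<open>auto simp: c_def\<close>)
      finally show "g z = (\<Sum>i\<in>{- k..k'}. c i * z powi i)" .
    next
      fix i assume i: "level i < int n"
      \<comment> \<open>For odd \<open>n\<close> the levels below \<open>n\<close> are those of
        \<open>-k, ..., k' - 1\<close>; the shift by \<open>k\<close> turns them into the powers
        orthogonal to \<open>\<Phi> n\<close>.\<close>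
      then have i': "0 \<le> i + k" "i + k < int n"
        using True unfolding level_def k_def by (auto split: if_splits; presburger)+
      have "(\<integral>z. cnj (z powi i) * g z \<partial>\<mu>) = (\<integral>z. cnj (z powi (i + k)) * poly (\<Phi> n) z \<partial>\<mu>)"
      proof (intro Bochner_Integration.integral_cong refl)
        fix z assume "z \<in> space \<mu>"
        then have n: "norm z = 1" by (simp add: space_circle[OF sets_\<mu>])
        then have "z \<noteq> 0" by auto
        then show "cnj (z powi i) * g z = cnj (z powi (i + k)) * poly (\<Phi> n) z"
          unfolding g_def norm_one_powi_minus[OF n] by (simp add: power_int_add)
      qed
      then show "(\<integral>z. cnj (z powi i) * g z \<partial>\<mu>) = 0"
        using monic_orthogonal_powi[OF \<Phi> i'] by simp
    qed (use lev in auto)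
    moreover have "cmod (g z) = cmod (poly (\<Phi> n) z)" if "norm z = 1" for z
      using that by (simp add: g_def norm_mult norm_power_int)
    ultimately show ?thesis by blast
  next
    case False
    \<comment> \<open>On the circle conjugation inverts \<open>z\<close>, so the leading coefficient
      of \<open>\<Phi> n\<close> sits at the exponent \<open>k' - n = -k\<close>, the one of level
      \<open>n\<close> when \<open>n\<close> is even.\<close>
    define c where "c i = cnj (coeff (\<Phi> n) (nat (k' - i)))" for i
    define g where "g z = z powi k' * cnj (poly (\<Phi> n) z)" for z
    have "\<exists>C>0. \<forall>l. (\<integral>z. z powi l * of_real ((cmod (g z))\<^sup>2) \<partial>\<mu>)
      = of_real C * cmv_pow True \<beta> l (delta (int n)) (int n)"
    proof (rule orthogonal_density[where A="{- k..k'}" and c=c and p="- k"])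
      show "level (- k) = int n" using False kk unfolding level_def k_def by auto
      show "c (- k) \<noteq> 0" using kk lc by (simp add: c_def add.commute)
      show "- k \<in> {- k..k'}" using kk by simp
    next
      fix z :: complex assume n: "norm z = 1"
      then have z: "z \<noteq> 0" by auto
      have "z powi k' * cnj (coeff (\<Phi> n) j * z ^ j) = cnj (coeff (\<Phi> n) j) * z powi (k' - int j)" for j
      proof -
        have "z powi (k' - int j) = z powi k' * z powi (- int j)"
          using z power_int_add[of z k' "- int j"] by simp
        then show ?thesis using norm_one_powi_minus[OF n, of "int j"] by simp
      qed
      then have "g z = (\<Sum>j\<le>n. cnj (coeff (\<Phi> n) j) * z powi (k' - int j))"
        unfolding g_def alt cnj_sum sum_distrib_left by (rule sum.cong[OF refl])
      also have "\<dots> = (\<Sum>i\<in>{- k..k'}. c i * z powi i)"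
        by (rule sum.reindex_bij_witness[of _ "\<lambda>i. nat (k' - i)" "\<lambda>j. k' - int j"])
           (use kk in \<open>auto simp: c_def\<close>)
      finally show "g z = (\<Sum>i\<in>{- k..k'}. c i * z powi i)" .
    next
      fix i assume i: "level i < int n"
      then have i': "0 \<le> k' - i" "k' - i < int n"
        using False unfolding level_def k'_def by (auto split: if_splits; presburger)+
      have "(\<integral>z. cnj (z powi i) * g z \<partial>\<mu>) = (\<integral>z. cnj (cnj (z powi (k' - i)) * poly (\<Phi> n) z) \<partial>\<mu>)"
      proof (intro Bochner_Integration.integral_cong refl)
        fix z assume "z \<in> space \<mu>"
        then have n: "norm z = 1" by (simp add: space_circle[OF sets_\<mu>])
        then have "z \<noteq> 0" by auto
        then have "z powi (k' - i) = z powi k' * z powi (- i)"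
          using power_int_add[of z k' "- i"] by simp
        then show "cnj (z powi i) * g z = cnj (cnj (z powi (k' - i)) * poly (\<Phi> n) z)"
          unfolding g_def norm_one_powi_minus[OF n] by simp
      qed
      also have "\<dots> = cnj 0"
        unfolding Bochner_Integration.integral_cnj using monic_orthogonal_powi[OF \<Phi> i'] by simp
      finally show "(\<integral>z. cnj (z powi i) * g z \<partial>\<mu>) = 0" by simp
    qed (use lev in auto)
    moreover have "cmod (g z) = cmod (poly (\<Phi> n) z)" if "norm z = 1" for z
      using that by (simp add: g_def norm_mult norm_power_int)
    ultimately show ?thesis by blast
  qed
  then obtain g where g: "\<And>z. norm z = 1 \<Longrightarrow> cmod (g z) = cmod (poly (\<Phi> n) z)"
    and C: "\<exists>C>0. \<forall>l. (\<integral>z. z powi l * of_real ((cmod (g z))\<^sup>2) \<partial>\<mu>)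
      = of_real C * cmv_pow True \<beta> l (delta (int n)) (int n)" by blast
  have "(\<integral>z. z powi l * of_real ((cmod (g z))\<^sup>2) \<partial>\<mu>)
      = (\<integral>z. z powi l * of_real ((cmod (poly (\<Phi> n) z))\<^sup>2) \<partial>\<mu>)" for l
    by (intro Bochner_Integration.integral_cong refl) (simp add: space_circle[OF sets_\<mu>] g)
  with C show ?thesis by simp
qed

lemma orthonormal_density:
  assumes "orthonormal_polys \<mu> \<phi>"
  shows "(\<integral>z. z powi l \<partial>density \<mu> (\<lambda>z. ennreal ((cmod (poly (\<phi> n) z))\<^sup>2)))
    = cmv_pow True \<beta> l (delta (int n)) (int n)"
proof -
  obtain \<Phi> where \<Phi>: "monic_orthogonal_polys \<mu> \<Phi>"
    and \<phi>: "\<phi> n = smult (complex_of_real (1 / L2_norm_poly \<mu> (\<Phi> n))) (\<Phi> n)"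
    using assms unfolding orthonormal_polys_def by blast
  obtain C where C: "C > 0" and d: "\<And>l. (\<integral>z. z powi l * of_real ((cmod (poly (\<Phi> n) z))\<^sup>2) \<partial>\<mu>)
    = of_real C * cmv_pow True \<beta> l (delta (int n)) (int n)"
    using monic_orthogonal_density[OF \<Phi>, of n] by blast
  \<comment> \<open>The case \<open>l = 0\<close> identifies \<open>C\<close>: the zeroth power is
    the identity, with diagonal entry 1, so \<open>C\<close> is the squared norm of
    \<open>\<Phi> n\<close>.\<close>
  have "complex_of_real (\<integral>z. (cmod (poly (\<Phi> n) z))\<^sup>2 \<partial>\<mu>) = of_real C"
    using d[of 0] by (simp add: delta_def flip: of_real_power)
  then have L: "(L2_norm_poly \<mu> (\<Phi> n))\<^sup>2 = C"
    using C unfolding L2_norm_poly_def of_real_eq_iff by simp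
  have \<phi>\<Phi>: "(cmod (poly (\<phi> n) z))\<^sup>2 = (cmod (poly (\<Phi> n) z))\<^sup>2 / C" for z
    unfolding \<phi> using L by (simp add: norm_mult power_mult_distrib norm_divide power_divide)
  have "(\<integral>z. z powi l \<partial>density \<mu> (\<lambda>z. ennreal ((cmod (poly (\<phi> n) z))\<^sup>2)))
    = (\<integral>z. (cmod (poly (\<phi> n) z))\<^sup>2 *\<^sub>R z powi l \<partial>\<mu>)"
    by (rule integral_density)
       (auto intro!: borel_measurable_circle[OF sets_\<mu>] continuous_intros)
  also have "\<dots> = (\<integral>z. of_real (1 / C) * (z powi l * of_real ((cmod (poly (\<Phi> n) z))\<^sup>2)) \<partial>\<mu>)"
    by (rule Bochner_Integration.integral_cong) (simp_all add: \<phi>\<Phi> scaleR_conv_of_real mult_ac)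
  also have "\<dots> = of_real (1 / C) * (of_real C * cmv_pow True \<beta> l (delta (int n)) (int n))"
    unfolding d[symmetric] by (rule integral_mult_right_zero)
  also have "\<dots> = cmv_pow True \<beta> l (delta (int n)) (int n)" using C by simp
  finally show ?thesis .
qed

end

section \<open>Right limits and the weak limit\<close>

theorem proposition1p11:
  fixes \<alpha> :: "nat \<Rightarrow> complex"
    and \<mu> :: "complex measure"
    and \<phi> :: "nat \<Rightarrow> complex poly"
  assumes "\<And>n. cmod (\<alpha> n) < 1"
    and "circle_prob \<mu>"
    and "infinite (circle_support \<mu>)"
    and "is_spectral_measure (half_line_cmv \<alpha>) (delta 0) \<mu>"
    and "orthonormal_polys \<mu> \<phi>"
    and "\<exists>\<nu>. weak_limit (\<lambda>n. density \<mu> (\<lambda>z. ennreal ((cmod (poly (\<phi> n) z))\<^sup>2))) \<nu>"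
  shows "\<forall>E. is_right_limit \<alpha> E \<longrightarrow> E \<in> khrushchev_class"
proof (intro allI impI)
  fix E assume "is_right_limit \<alpha> E"
  then obtain N :: "nat \<Rightarrow> int" and \<beta> where N: "filterlim N at_top sequentially"
    and lim: "\<And>k. (\<lambda>j. \<alpha> (nat (k + N j))) \<longlonglongrightarrow> \<beta> k" and E: "E = whole_line_cmv \<beta>"
    unfolding is_right_limit_def by blast
  obtain \<nu> where \<nu>: "circle_prob \<nu>"
    and weak: "\<And>f :: complex \<Rightarrow> complex. continuous_on (sphere 0 1) f \<Longrightarrow>
      (\<lambda>n. \<integral>z. f z \<partial>density \<mu> (\<lambda>z. ennreal ((cmod (poly (\<phi> n) z))\<^sup>2))) \<longlonglongrightarrow> (\<integral>z. f z \<partial>\<nu>)"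
    using assms(6) unfolding weak_limit_def by blast
  have le1: "\<forall>k. cmod (\<beta> k) \<le> 1"
  proof
    fix k
    have "\<forall>j\<ge>0. cmod (\<alpha> (nat (k + N j))) \<le> 1" using assms(1) by (simp add: less_imp_le)
    then show "cmod (\<beta> k) \<le> 1" by (intro LIMSEQ_le_const2[OF tendsto_norm[OF lim]]) blast
  qed
  interpret half_line "extend \<alpha>" \<mu>
  proof (rule half_line.intro)
    show "\<forall>n. cmod (extend \<alpha> n) \<le> 1"
      using assms(1) by (simp add: extend_def less_imp_le)
    show "cmod (extend \<alpha> n) < 1" if "n \<ge> 0" for n
      using assms(1) that by (simp add: extend_def)
    show "extend \<alpha> (- 1) = - 1"
      by (simp add: extend_def)
    show "sets \<mu> = sets circle_algebra" and "finite_measure \<mu>"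
      using assms(4) unfolding is_spectral_measure_def by blast+
    show "(\<integral>z. z powi l \<partial>\<mu>) = cmv_pow True (extend \<alpha>) l (delta 0) 0" for l
      by (rule half_line_moments[OF assms(4)])
  qed
  have N': "\<forall>\<^sub>F j in sequentially. 0 \<le> k + N j" for k
  proof -
    have "\<forall>\<^sub>F j in sequentially. - k \<le> N j" using N by (simp add: filterlim_at_top)
    then show ?thesis by (rule eventually_mono) simp
  qed
  \<comment> \<open>Once \<open>k + N j\<close> is nonnegative, \<open>extend\<close> and the
    truncation by \<open>nat\<close> read the same coefficient of \<open>\<alpha>\<close>.\<close>
  have translate_lim: "(\<lambda>j. translate (N j) (extend \<alpha>) k) \<longlonglongrightarrow> \<beta> k" for k
    using lim[of k]
    by (rule Lim_transform_eventually, intro eventually_mono[OF N'[of k]])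
       (simp add: translate_def extend_def)
  \<comment> \<open>One sequence with two limits: entrywise continuity gives the right limit, while
    the diagonal entries along \<open>nat (k + N j)\<close> are moments of the weakly convergent
    measures.\<close>
  have diag: "cmv_pow True \<beta> l (delta k) k = (\<integral>z. z powi l \<partial>\<nu>)" for l k
  proof (rule LIMSEQ_unique)
    show "(\<lambda>j. cmv_pow True (translate (N j) (extend \<alpha>)) l (delta k) k) \<longlonglongrightarrow> cmv_pow True \<beta> l (delta k) k"
      by (rule tendsto_cmv_pow[OF translate_lim])
    have nat_lim: "filterlim (\<lambda>j. nat (k + N j)) at_top sequentially"
    proof (rule filterlim_compose[OF filterlim_nat_sequentially])
      show "filterlim (\<lambda>j. k + N j) at_top sequentially"
        unfolding filterlim_at_top
      proof
        fix Z
        have "\<forall>\<^sub>F j in sequentially. Z - k \<le> N j" using N by (simp add: filterlim_at_top)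
        then show "\<forall>\<^sub>F j in sequentially. Z \<le> k + N j" by (rule eventually_mono) simp
      qed
    qed
    have "(\<lambda>n. cmv_pow True (extend \<alpha>) l (delta (int n)) (int n)) \<longlonglongrightarrow> (\<integral>z. z powi l \<partial>\<nu>)"
    proof -
      have "continuous_on (sphere 0 1) (\<lambda>z :: complex. z powi l)"
        by (auto intro!: continuous_intros)
      from weak[OF this] show ?thesis unfolding orthonormal_density[OF assms(5)] .
    qed
    from filterlim_compose[OF this nat_lim]
    show "(\<lambda>j. cmv_pow True (translate (N j) (extend \<alpha>)) l (delta k) k) \<longlonglongrightarrow> (\<integral>z. z powi l \<partial>\<nu>)"
      by (rule Lim_transform_eventually, intro eventually_mono[OF N'[of k]])
         (simp add: cmv_pow_translate_diag)
  qed
  \<comment> \<open>The moments in \<open>diag\<close> do not involve \<open>k\<close>, so the weak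
    limit itself is a spectral measure for every basis vector.\<close>
  have "is_spectral_measure E (delta k) \<nu>" for k
    using \<nu> by (simp add: is_spectral_measure_def circle_prob_def prob_space.finite_measure
        E op_powi_whole_line[OF le1] diag)
  with le1 E show "E \<in> khrushchev_class"
    unfolding khrushchev_class_def by (auto intro!: exI[of _ "\<lambda>_. \<nu>"])
qed

end
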